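(* Let $\eta\in(0,1)$ satisfy $\eta^3+\eta^2=1$. For every rational $b$ with $0<b<15/16$, set $$A_b=\begin{pmatrix}5-2b&b\\2b&3/2-b\end{pmatrix},\qquad D=\operatorname{diag}(1,2).$$ Then $A_bD$ is positive definite with positive cross term, its positive Nahm solution is $(\eta,\eta^2)$, and its radial action is $\pi^2/12$. In particular, $b=1/2$ gives the convergent family $$\sum_{r,s\ge0}\frac{q^{2r^2+rs+s^2+\ell_1r+\ell_2s}}{(q;q)_r(q^2;q^2)_s},$$ convergent for every choice of fixed rational linear coefficients $\ell_1,\ell_2$.
   Context: Here $|q|<1$ and $(x;q)_n=\prod_{j=0}^{n-1}(1-xq^j)$; for noninteger exponents a choice $q=e^{2\pi i\tau}$, $q^t=e^{2\pi it\tau}$ with $\operatorname{Im}\tau>0$ is fixed. For a rational matrix $A$ with $D=\operatorname{diag}(d_1,d_2)$ and $AD$ symmetric positive definite, the cross term is the off-diagonal entry of $AD$; the positive Nahm solution is the unique $(z_1,z_2)\in(0,1)^2$ with $1-z_i=\prod_jz_j^{A_{ij}}$ for $i=1,2$ (positive real powers); the radial action is $\Lambda=\sum_i\frac{L(1)-L(z_i)}{d_i}$, where $L(x)=\operatorname{Li}_2(x)+\tfrac12\log x\log(1-x)$ for $0<x<1$ and $L(1)=\pi^2/6$. The sum attached to $(A,D)$ has quadratic exponent $\tfrac12(r,s)AD(r,s)^T$ and denominators $(q^{d_1};q^{d_1})_r(q^{d_2};q^{d_2})_s$. *)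

theory Defs
  imports "HOL-Analysis.Analysis"
begin

definition diag_matrix :: "real^2 \<Rightarrow> real^2^2" where
  "diag_matrix d = (\<chi> i j. if i = j then d $ i else 0)"

definition symmetric_positive_definite :: "real^2^2 \<Rightarrow> bool" where
  "symmetric_positive_definite M \<longleftrightarrow>
     transpose M = M \<and> (\<forall>x. x \<noteq> 0 \<longrightarrow> 0 < x \<bullet> (M *v x))"

(* In what follows the vector d holds the diagonal entries of D. *)

definition cross_term :: "real^2^2 \<Rightarrow> real^2 \<Rightarrow> real" where
  "cross_term A d = (A ** diag_matrix d) $ 1 $ 2"

definition is_nahm_solution :: "real^2^2 \<Rightarrow> real^2 \<Rightarrow> bool" where
  "is_nahm_solution A z \<longleftrightarrow>
     (\<forall>i. 0 < z $ i \<and> z $ i < 1) \<and>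
     (\<forall>i. 1 - z $ i = (\<Prod>j\<in>UNIV. z $ j powr A $ i $ j))"

(* Meaningful only when the solution in the open unit square exists and is unique. *)
definition positive_nahm_solution :: "real^2^2 \<Rightarrow> real^2" where
  "positive_nahm_solution A = (THE z. is_nahm_solution A z)"

definition Li2 :: "real \<Rightarrow> real" where
  "Li2 x = (\<Sum>n. x ^ Suc n / (real (Suc n))\<^sup>2)"

(* Rogers dilogarithm, used only on the half-open interval (0, 1]. *)
definition rogers_L :: "real \<Rightarrow> real" where
  "rogers_L x = (if x = 1 then pi\<^sup>2 / 6 else Li2 x + ln x * ln (1 - x) / 2)"

definition radial_action :: "real^2^2 \<Rightarrow> real^2 \<Rightarrow> real" where
  "radial_action A d =
     (\<Sum>i\<in>UNIV. (rogers_L 1 - rogers_L (positive_nahm_solution A $ i)) / d $ i)"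

(* The power q^t for the branch fixed by q = exp (2 pi i tau). *)
definition qpow :: "complex \<Rightarrow> real \<Rightarrow> complex" where
  "qpow \<tau> t = exp (2 * of_real pi * \<i> * of_real t * \<tau>)"

definition qpoch :: "complex \<Rightarrow> complex \<Rightarrow> nat \<Rightarrow> complex" where
  "qpoch x q n = (\<Prod>j<n. 1 - x * q ^ j)"

(* The (r, s) summand attached to (A, D) with linear coefficients l, at q = exp (2 pi i tau). *)
definition nahm_term ::
    "real^2^2 \<Rightarrow> real^2 \<Rightarrow> real^2 \<Rightarrow> complex \<Rightarrow> nat \<Rightarrow> nat \<Rightarrow> complex" where
  "nahm_term A d l \<tau> r s =
     (let v = vector [real r, real s] :: real^2
      in qpow \<tau> (v \<bullet> ((A ** diag_matrix d) *v v) / 2 + l \<bullet> v) /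
         (qpoch (qpow \<tau> (d $ 1)) (qpow \<tau> (d $ 1)) r *
          qpoch (qpow \<tau> (d $ 2)) (qpow \<tau> (d $ 2)) s))"

definition A_mat :: "real \<Rightarrow> real^2^2" where
  "A_mat b = vector [vector [5 - 2 * b, b], vector [2 * b, 3/2 - b]]"

definition d_vec :: "real^2" where
  "d_vec = vector [1, 2]"

end

theory Submission
  imports Defs "HOL-Real_Asymp.Real_Asymp"
begin

text \<open>
  \<^bold>\<open>Positive definiteness.\<close> The quadratic form of \<open>A_b D\<close> has determinant
  \<open>15 - 16 b\<close>, which is where the bound \<open>b < 15/16\<close> comes from; completing the
  square does the rest.

  \<^bold>\<open>Nahm solution.\<close> The cubic \<open>\<eta>\<^sup>3 + \<eta>\<^sup>2 = 1\<close> gives both \<open>1 - \<eta>\<^sup>2 = \<eta>\<^sup>3\<close> and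
  \<open>1 - \<eta> = \<eta>\<^sup>5\<close>. At \<open>(\<eta>, \<eta>\<^sup>2)\<close> the products in Nahm's equations are powers of \<open>\<eta>\<close> in
  whose exponents \<open>b\<close> cancels, leaving \<open>\<eta>\<^sup>5\<close> and \<open>\<eta>\<^sup>3\<close>; hence one solution serves the
  whole family (\<open>A_mat_nahm_solution\<close>). It is the only one because, in the variables
  \<open>ln z_i\<close> and up to the positive weights \<open>d_i\<close>, Nahm's equations equate a linear map that
  is strictly monotone, by definiteness, with one that decreases in each coordinate
  (\<open>nahm_solution_unique\<close>).

  \<^bold>\<open>Radial action.\<close> The claim amounts to \<open>2 L(\<eta>) + L(\<eta>\<^sup>2) = 2 L(1)\<close>. Since
  \<open>\<eta> / (1 + \<eta>) = \<eta>\<^sup>3 = 1 - \<eta>\<^sup>2\<close>, Abel's duplication formula at \<open>\<eta>\<close> relates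
  \<open>L(\<eta>)\<close>, \<open>L(\<eta>\<^sup>2)\<close> and \<open>L(\<eta>\<^sup>3)\<close>, while Euler's reflection formula at \<open>\<eta>\<^sup>2\<close> relates the last
  two; eliminating \<open>L(\<eta>\<^sup>3)\<close> gives it (\<open>rogers_L_plastic\<close>). Both formulas hold because the difference of
  their sides is continuous on \<open>[0, 1]\<close>, has derivative \<open>0\<close> inside and vanishes at \<open>0\<close>.

  \<^bold>\<open>Convergence.\<close> As \<open>rs \<ge> 0\<close>, the numerator is at most a product of Gaussians in \<open>r\<close>
  and in \<open>s\<close>, while the reciprocals of the Pochhammer symbols grow at most
  exponentially.
\<close>

section \<open>Uniqueness of the positive Nahm solution\<close>

lemma matrix_mul_diag_entry:
  "(A ** diag_matrix d) $ i $ j = A $ i $ j * d $ j"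
  by (simp add: matrix_matrix_mult_def diag_matrix_def if_distrib cong: if_cong)

lemma nahm_solution_ln:
  assumes "is_nahm_solution A z"
  shows "ln (1 - z $ i) = (\<Sum>j\<in>UNIV. A $ i $ j * ln (z $ j))"
proof -
  have pos: "0 < z $ j" for j
    using assms by (auto simp: is_nahm_solution_def)
  have "ln (1 - z $ i) = ln (\<Prod>j\<in>UNIV. z $ j powr A $ i $ j)"
    using assms by (simp add: is_nahm_solution_def)
  also have "\<dots> = (\<Sum>j\<in>UNIV. ln (z $ j powr A $ i $ j))"
    using pos by (intro ln_prod) (auto simp: less_imp_neq[THEN not_sym])
  also have "\<dots> = (\<Sum>j\<in>UNIV. A $ i $ j * ln (z $ j))"
    using pos by (simp add: ln_powr less_imp_neq[THEN not_sym])
  finally show ?thesis .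
qed

text \<open>
  For two solutions, put \<open>y = D\<^sup>-\<^sup>1 (ln z - ln w)\<close>. The logarithmic equations say that
  \<open>A D y = ln (1 - z) - ln (1 - w)\<close>, whose entries have signs opposite to those of \<open>y\<close>
  since \<open>D\<close> is positive and \<open>x \<mapsto> ln (1 - x)\<close> decreases. So the form of \<open>A D\<close> is at most \<open>0\<close> at \<open>y\<close>, and
  definiteness forces \<open>y = 0\<close>.
\<close>
lemma nahm_solution_unique:
  assumes spd: "symmetric_positive_definite (A ** diag_matrix d)"
    and d: "\<And>i. 0 < d $ i"
    and z: "is_nahm_solution A z" and w: "is_nahm_solution A w"
  shows "z = w"
proof -
  have z01: "0 < z $ i" "z $ i < 1" and w01: "0 < w $ i" "w $ i < 1" for i
    using z w by (auto simp: is_nahm_solution_def)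
  define y :: "real^2" where "y = (\<chi> i. (ln (z $ i) - ln (w $ i)) / d $ i)"
  have My: "((A ** diag_matrix d) *v y) $ i = ln (1 - z $ i) - ln (1 - w $ i)" for i
  proof -
    have "d $ j * y $ j = ln (z $ j) - ln (w $ j)" for j
      using d[of j] by (simp add: y_def)
    then have "((A ** diag_matrix d) *v y) $ i = (\<Sum>j\<in>UNIV. A $ i $ j * (ln (z $ j) - ln (w $ j)))"
      by (simp add: matrix_vector_mult_def matrix_mul_diag_entry mult.assoc)
    also have "\<dots> = ln (1 - z $ i) - ln (1 - w $ i)"
      by (simp add: nahm_solution_ln[OF z] nahm_solution_ln[OF w] right_diff_distrib sum_subtractf)
    finally show ?thesis .
  qed
  have "y $ i * (ln (1 - z $ i) - ln (1 - w $ i)) \<le> 0" for i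
  proof (cases "z $ i \<le> w $ i")
    case True
    then have "y $ i \<le> 0"
      using z01[of i] w01[of i] d[of i] by (simp add: y_def divide_le_0_iff)
    moreover have "0 \<le> ln (1 - z $ i) - ln (1 - w $ i)"
      using True z01[of i] w01[of i] by simp
    ultimately show ?thesis by (simp add: mult_nonpos_nonneg)
  next
    case False
    then have "0 \<le> y $ i"
      using z01[of i] w01[of i] d[of i] by (simp add: y_def)
    moreover have "ln (1 - z $ i) - ln (1 - w $ i) \<le> 0"
      using False z01[of i] w01[of i] by simp
    ultimately show ?thesis by (simp add: mult_nonneg_nonpos)
  qed
  then have "y \<bullet> ((A ** diag_matrix d) *v y) \<le> 0"
    by (simp add: inner_vec_def My sum_nonpos)
  then have "y = 0"
    using spd unfolding symmetric_positive_definite_def by (meson not_less)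
  then have "y $ i = 0" for i
    by simp
  then have "ln (z $ i) = ln (w $ i) \<or> d $ i = 0" for i
    by (simp add: y_def)
  then have "ln (z $ i) = ln (w $ i)" for i
    using d[of i] by (metis less_irrefl)
  then show "z = w"
    using z01 w01 by (simp add: vec_eq_iff)
qed

section \<open>The Rogers dilogarithm\<close>

lemma sums_zeta2: "(\<lambda>n. 1 / (real (Suc n))\<^sup>2) sums (pi\<^sup>2 / 6)"
  using inverse_squares_sums by (simp add: add.commute)

lemma Li2_1: "Li2 1 = pi\<^sup>2 / 6"
  using sums_unique[OF sums_zeta2] by (simp add: Li2_def)

lemma Li2_0: "Li2 0 = 0"
  by (simp add: Li2_def)

text \<open>
  Continuity up to the endpoint \<open>1\<close> is what lets \<open>\<zeta>(2)\<close> enter the reflection formula.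
\<close>
lemma continuous_on_Li2: "continuous_on {-1..1} Li2"
proof -
  have "uniform_limit {-1..1} (\<lambda>n x. \<Sum>i<n. x ^ Suc i / (real (Suc i))\<^sup>2)
      (\<lambda>x. \<Sum>i. x ^ Suc i / (real (Suc i))\<^sup>2) sequentially"
  proof (rule Weierstrass_m_test)
    fix n :: nat and x :: real
    assume "x \<in> {-1..1}"
    then have "\<bar>x\<bar> ^ Suc n \<le> 1"
      by (intro power_le_one) auto
    then show "norm (x ^ Suc n / (real (Suc n))\<^sup>2) \<le> 1 / (real (Suc n))\<^sup>2"
      by (simp add: power_abs[symmetric] abs_mult divide_right_mono)
  qed (use sums_zeta2 in \<open>simp add: sums_iff\<close>)
  then have "continuous_on {-1..1} (\<lambda>x. \<Sum>i. x ^ Suc i / (real (Suc i))\<^sup>2)"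
    by (rule uniform_limit_theorem[rotated]) (auto intro!: always_eventually continuous_intros)
  then show ?thesis by (simp add: Li2_def[abs_def])
qed

lemma DERIV_Li2:
  assumes "0 < x" "x < 1"
  shows "(Li2 has_real_derivative - ln (1 - x) / x) (at x)"
proof -
  \<comment> \<open>As \<open>1 / 0 = 0\<close>, the constant coefficient vanishes.\<close>
  define c :: "nat \<Rightarrow> real" where "c n = 1 / (real n)\<^sup>2" for n
  have summable_c: "summable (\<lambda>n. c n * t ^ n)" if "norm t < 1" for t
  proof (rule summable_comparison_test')
    show "summable (\<lambda>n. \<bar>t\<bar> ^ n)"
      using that by (intro summable_geometric) simp
    show "norm (c n * t ^ n) \<le> \<bar>t\<bar> ^ n" for n
    proof -
      have "\<bar>c n\<bar> \<le> 1"
        by (cases "n = 0") (auto simp: c_def)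
      then show ?thesis
        by (simp add: abs_mult power_abs mult_left_le_one_le)
    qed
  qed
  have Li2_c: "Li2 t = (\<Sum>n. c n * t ^ n)" if "norm t < 1" for t
    using suminf_split_head[OF summable_c[OF that]] by (simp add: Li2_def c_def)
  have "((\<lambda>t. \<Sum>n. c n * t ^ n) has_real_derivative (\<Sum>n. diffs c n * x ^ n)) (at x)"
    by (rule termdiffs_strong'[where K = 1]) (use assms summable_c in auto)
  moreover have "(\<Sum>n. diffs c n * x ^ n) = - ln (1 - x) / x"
  proof -
    have coeff: "diffs c n * x ^ n = x ^ Suc n / real (Suc n) / x" for n
      using assms by (simp add: diffs_def c_def power2_eq_square)
    have summ: "summable (\<lambda>n. x ^ Suc n / real (Suc n))"
    proof (rule summable_comparison_test')
      show "summable (\<lambda>n. x * x ^ n)"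
        using assms by (intro summable_mult summable_geometric) simp
      show "norm (x ^ Suc n / real (Suc n)) \<le> x * x ^ n" for n
        using assms mult_left_le[of "inverse (real (Suc n))" "x * x ^ n"]
        by (simp add: divide_inverse inverse_le_1_iff)
    qed
    have "ln (1 - x) = (\<Sum>n. (-1) ^ n * (1 / real (n + 1)) * (- x) ^ Suc n)"
      using ln_series[of "1 - x"] assms by simp
    also have "\<dots> = (\<Sum>n. - (x ^ Suc n / real (Suc n)))"
      by (intro suminf_cong) (simp add: power_minus[of x])
    also have "\<dots> = - (\<Sum>n. x ^ Suc n / real (Suc n))"
      using summ by (rule suminf_minus)
    finally show ?thesis
      unfolding coeff suminf_divide[OF summ] by simp
  qed
  ultimately have "((\<lambda>t. \<Sum>n. c n * t ^ n) has_real_derivative - ln (1 - x) / x) (at x)"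
    by simp
  then show ?thesis
  proof (rule has_field_derivative_transform_within_open)
    show "open {0<..<1::real}" by simp
  qed (use assms Li2_c in auto)
qed

text \<open>
  The separate value at \<open>1\<close> agrees with the general formula, because \<open>ln 1 = 0\<close>;
  likewise \<open>ln (1 - 0) = 0\<close> makes the formula give the limit \<open>0\<close> at \<open>0\<close>. Hence \<open>L\<close> can
  be treated as one continuous function on \<open>[0, 1]\<close>.
\<close>
lemma rogers_L_eq: "rogers_L x = Li2 x + ln x * ln (1 - x) / 2"
  by (simp add: rogers_L_def Li2_1)

lemma rogers_L_0: "rogers_L 0 = 0"
  by (simp add: rogers_L_eq Li2_0)

lemma rogers_L_1: "rogers_L 1 = pi\<^sup>2 / 6"
  by (simp add: rogers_L_def)

lemma continuous_on_rogers_L: "continuous_on {0..1} rogers_L"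
proof -
  have "continuous_on {0..1} (\<lambda>x::real. ln x * ln (1 - x))"
    unfolding continuous_on_def
  proof
    fix x :: real
    assume "x \<in> {0..1}"
    then consider "x = 0" | "x = 1" | "0 < x" "x < 1"
      by fastforce
    then show "((\<lambda>x. ln x * ln (1 - x)) \<longlongrightarrow> ln x * ln (1 - x)) (at x within {0..1})"
    proof cases
      case 1
      have "((\<lambda>x::real. ln x * ln (1 - x)) \<longlongrightarrow> 0) (at_right 0)"
        by real_asymp
      then show ?thesis using 1 by (simp add: at_within_Icc_at_right)
    next
      case 2
      have "((\<lambda>x::real. ln x * ln (1 - x)) \<longlongrightarrow> 0) (at_left 1)"
        by real_asymp
      then show ?thesis using 2 by (simp add: at_within_Icc_at_left)
    next
      case 3
      then show ?thesis by (intro tendsto_intros) auto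
    qed
  qed
  moreover have "continuous_on {0..1} Li2"
    by (rule continuous_on_subset[OF continuous_on_Li2]) auto
  ultimately show ?thesis
    unfolding rogers_L_eq[abs_def]
    by (intro continuous_on_add continuous_on_divide continuous_on_const) auto
qed

lemma DERIV_rogers_L:
  assumes "0 < x" "x < 1"
  shows "(rogers_L has_real_derivative - (ln (1 - x) / x + ln x / (1 - x)) / 2) (at x)"
  unfolding rogers_L_eq[abs_def]
  using assms by (auto intro!: derivative_eq_intros DERIV_Li2 simp: field_simps)

text \<open>Euler's reflection formula: the derivative of \<open>L\<close> is symmetric under \<open>x \<mapsto> 1 - x\<close>.\<close>
lemma rogers_L_reflection:
  assumes "0 < x" "x < 1"
  shows "rogers_L x + rogers_L (1 - x) = rogers_L 1"
proof -
  have "rogers_L x + rogers_L (1 - x) = rogers_L 0 + rogers_L (1 - 0)"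
  proof (rule DERIV_isconst2[of 0 1 "\<lambda>t. rogers_L t + rogers_L (1 - t)"])
    show "continuous_on {0..1} (\<lambda>t. rogers_L t + rogers_L (1 - t))"
      by (intro continuous_intros continuous_on_compose2[OF continuous_on_rogers_L]) auto
    show "((\<lambda>t. rogers_L t + rogers_L (1 - t)) has_real_derivative 0) (at t)"
      if "0 < t" "t < 1" for t
      using that by (auto intro!: derivative_eq_intros DERIV_rogers_L DERIV_chain2[OF DERIV_rogers_L])
  qed (use assms in auto)
  then show ?thesis by (simp add: rogers_L_0)
qed

text \<open>
  Abel's duplication formula. After expanding the logarithms of \<open>1 - t\<^sup>2\<close> and
  \<open>t / (1 + t)\<close>, the derivative of the difference of the two sides is a combination of
  \<open>ln t\<close>, \<open>ln (1 - t)\<close> and \<open>ln (1 + t)\<close> whose coefficients are rational functions of \<open>t\<close>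
  that vanish identically.
\<close>
lemma rogers_L_duplication:
  assumes "0 < x" "x < 1"
  shows "rogers_L (x\<^sup>2) = 2 * rogers_L x - 2 * rogers_L (x / (1 + x))"
proof -
  define f where "f t = rogers_L (t\<^sup>2) - 2 * rogers_L t + 2 * rogers_L (t / (1 + t))" for t
  have "f x = f 0"
  proof (rule DERIV_isconst2[of 0 1])
    show "continuous_on {0..1} f"
      unfolding f_def
      by (intro continuous_intros continuous_on_compose2[OF continuous_on_rogers_L])
         (auto simp: power_le_one divide_le_eq)
    show "(f has_real_derivative 0) (at t)" if t: "0 < t" "t < 1" for t
    proof -
      have t2: "0 < t\<^sup>2" "t\<^sup>2 < 1" and tt: "0 < t / (1 + t)" "t / (1 + t) < 1"
        using t by (auto simp: power_less_one_iff divide_less_eq)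
      have "1 - t\<^sup>2 = (1 - t) * (1 + t)"
        by (simp add: power2_eq_square algebra_simps)
      then have ln2: "ln (1 - t\<^sup>2) = ln (1 - t) + ln (1 + t)"
        using t by (simp add: ln_mult)
      have ln3: "1 - t / (1 + t) = 1 / (1 + t)" "ln (1 / (1 + t)) = - ln (1 + t)"
        using t by (simp_all add: ln_div field_simps)
      have ln4: "ln (t / (1 + t)) = ln t - ln (1 + t)" "ln (t\<^sup>2) = 2 * ln t"
        using t by (simp_all add: ln_div ln_realpow)
      have d1: "((\<lambda>t. rogers_L (t\<^sup>2)) has_real_derivative
          - (ln (1 - t\<^sup>2) / t\<^sup>2 + ln (t\<^sup>2) / (1 - t\<^sup>2)) / 2 * (2 * t)) (at t)"
        by (rule DERIV_chain2[where g = "\<lambda>t. t\<^sup>2", OF DERIV_rogers_L[OF t2]])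
           (auto intro!: derivative_eq_intros)
      have d2: "((\<lambda>t. rogers_L (t / (1 + t))) has_real_derivative
          - (ln (1 - t / (1 + t)) / (t / (1 + t)) + ln (t / (1 + t)) / (1 - t / (1 + t))) / 2
            * (1 / (1 + t)\<^sup>2)) (at t)"
        by (rule DERIV_chain2[where g = "\<lambda>t. t / (1 + t)", OF DERIV_rogers_L[OF tt]])
           (use t in \<open>auto intro!: derivative_eq_intros simp: power2_eq_square\<close>)
      define u v w where "u = ln t" and "v = ln (1 - t)" and "w = ln (1 + t)"
      have "- ((v + w) / t\<^sup>2 + 2 * u / (1 - t\<^sup>2)) / 2 * (2 * t)
          - 2 * (- (v / t + u / (1 - t)) / 2)
          + 2 * (- ((- w) / (t / (1 + t)) + (u - w) / (1 / (1 + t))) / 2 * (1 / (1 + t)\<^sup>2)) = 0"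
      proof -
        have a: "2 * u / (1 - t\<^sup>2) * t = u / (1 - t) - u / (1 + t)"
        proof -
          have "1 - t\<^sup>2 \<noteq> 0" "1 - t \<noteq> 0" "1 + t \<noteq> 0" using t t2 by auto
          then show ?thesis by (simp add: divide_simps) (simp add: power2_eq_square algebra_simps)
        qed
        have b: "((- w) / (t / (1 + t)) + (u - w) / (1 / (1 + t))) * (1 / (1 + t)\<^sup>2)
            = - w / t + u / (1 + t)"
        proof -
          have "t \<noteq> 0" "1 + t \<noteq> 0" using t by auto
          then show ?thesis by (simp add: divide_simps) (simp add: power2_eq_square algebra_simps)
        qed
        have c: "(v + w) / t\<^sup>2 * t = v / t + w / t"
          using t by (simp add: power2_eq_square field_simps)
        have regroup: "- (X + Y) / 2 * (2 * t) - 2 * (- W / 2) + 2 * (- Z / 2 * P)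
            = W - X * t - Y * t - Z * P" for X Y W Z P :: real
          by (simp add: field_simps)
        show ?thesis
          unfolding regroup a b c by simp
      qed
      then show ?thesis
        unfolding f_def
        by (intro DERIV_cong[OF DERIV_add[OF
              DERIV_diff[OF d1 DERIV_cmult[OF DERIV_rogers_L[OF t]]] DERIV_cmult[OF d2]]])
           (simp only: ln2 ln3 ln4 u_def v_def w_def)
    qed
  qed (use assms in auto)
  then show ?thesis by (simp add: f_def rogers_L_0)
qed

text \<open>
  The number \<open>\<eta>\<close> is the reciprocal of the plastic number. The first step is
  \<open>\<eta> / (1 + \<eta>) = \<eta>\<^sup>3\<close>, that is \<open>\<eta>\<^sup>2 (1 + \<eta>) = 1\<close>, written so that reflection applies.
\<close>
lemma rogers_L_plastic:
  fixes \<eta> :: real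
  assumes "0 < \<eta>" "\<eta> < 1" "\<eta> ^ 3 + \<eta> ^ 2 = 1"
  shows "2 * rogers_L \<eta> + rogers_L (\<eta>\<^sup>2) = pi\<^sup>2 / 3"
proof -
  have "\<eta> / (1 + \<eta>) = 1 - \<eta>\<^sup>2"
  proof -
    have "(1 - \<eta>\<^sup>2) * (1 + \<eta>) = \<eta> + (1 - (\<eta> ^ 3 + \<eta> ^ 2))"
      by (simp add: power2_eq_square power3_eq_cube algebra_simps)
    then show ?thesis using assms by (simp add: divide_eq_eq)
  qed
  moreover have "rogers_L (\<eta>\<^sup>2) + rogers_L (1 - \<eta>\<^sup>2) = rogers_L 1"
    using assms by (intro rogers_L_reflection) (auto simp: power_less_one_iff)
  ultimately show ?thesis
    using rogers_L_duplication[OF assms(1,2)] by (simp add: rogers_L_1)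
qed

section \<open>The matrices \<open>A_b\<close>\<close>

lemma A_mat_entries [simp]:
  "A_mat b $ 1 $ 1 = 5 - 2 * b" "A_mat b $ 1 $ 2 = b"
  "A_mat b $ 2 $ 1 = 2 * b" "A_mat b $ 2 $ 2 = 3/2 - b"
  by (simp_all add: A_mat_def)

lemma d_vec_entries [simp]: "d_vec $ 1 = 1" "d_vec $ 2 = 2"
  by (simp_all add: d_vec_def)

lemma d_vec_pos: "0 < d_vec $ i"
  using exhaust_2[of i] by auto

lemma A_mat_quadratic_form:
  "x \<bullet> ((A_mat b ** diag_matrix d_vec) *v x)
     = (5 - 2 * b) * (x $ 1)\<^sup>2 + 4 * b * (x $ 1 * x $ 2) + (3 - 2 * b) * (x $ 2)\<^sup>2"
  by (simp add: inner_vec_def sum_2 matrix_vector_mult_def matrix_mul_diag_entry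
      power2_eq_square algebra_simps)

lemma A_mat_spd:
  assumes "b < 15/16"
  shows "symmetric_positive_definite (A_mat b ** diag_matrix d_vec)"
  unfolding symmetric_positive_definite_def
proof (intro conjI allI impI)
  show "transpose (A_mat b ** diag_matrix d_vec) = A_mat b ** diag_matrix d_vec"
    by (simp add: vec_eq_iff forall_2 transpose_def matrix_mul_diag_entry)
next
  fix x :: "real^2"
  assume "x \<noteq> 0"
  then have x: "x $ 1 \<noteq> 0 \<or> x $ 2 \<noteq> 0"
    by (simp add: vec_eq_iff forall_2)
  \<comment> \<open>Complete the square in the first coordinate, clearing the positive factor \<open>5 - 2 b\<close>.\<close>
  define Q where "Q = x \<bullet> ((A_mat b ** diag_matrix d_vec) *v x)"
  have "(5 - 2 * b) * Q = ((5 - 2 * b) * x $ 1 + 2 * b * x $ 2)\<^sup>2 + (15 - 16 * b) * (x $ 2)\<^sup>2"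
    by (simp add: Q_def A_mat_quadratic_form power2_eq_square algebra_simps)
  also have "\<dots> > 0"
  proof (cases "x $ 2 = 0")
    case True
    then show ?thesis using x assms by simp
  next
    case False
    then show ?thesis using assms by (intro add_nonneg_pos) auto
  qed
  finally show "0 < Q"
    using assms by (simp add: zero_less_mult_iff)
qed

text \<open>
  The exponents of \<open>\<eta>\<close> are \<open>(5 - 2 b) + 2 b = 5\<close> and \<open>2 b + 2 (3/2 - b) = 3\<close>. The equation
  \<open>\<eta>\<^sup>5 = 1 - \<eta>\<close> holds because \<open>x\<^sup>3 + x\<^sup>2 - 1\<close> divides \<open>x\<^sup>5 + x - 1\<close>.
\<close>
lemma A_mat_nahm_solution:
  fixes \<eta> :: real
  assumes "0 < \<eta>" "\<eta> < 1" "\<eta> ^ 3 + \<eta> ^ 2 = 1"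
  shows "is_nahm_solution (A_mat b) (vector [\<eta>, \<eta>\<^sup>2])"
proof -
  have powr2: "(\<eta>\<^sup>2) powr a = \<eta> powr (2 * a)" for a
    using assms by (simp add: powr_powr flip: powr_numeral)
  have "\<eta> powr (5 - 2 * b) * (\<eta>\<^sup>2) powr b = \<eta> ^ 5"
    using assms by (simp add: powr2 flip: powr_add)
  moreover have "1 - \<eta> = \<eta> ^ 5"
  proof -
    have "\<eta> ^ 5 + \<eta> - 1 = (\<eta> ^ 3 + \<eta> ^ 2 - 1) * (\<eta>\<^sup>2 - \<eta> + 1)"
      by (simp add: eval_nat_numeral algebra_simps)
    then show ?thesis using assms by simp
  qed
  moreover have "\<eta> powr (2 * b) * (\<eta>\<^sup>2) powr (3/2 - b) = \<eta> ^ 3"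
    using assms by (simp add: powr2 algebra_simps flip: powr_add)
  moreover have "1 - \<eta>\<^sup>2 = \<eta> ^ 3"
    using assms by simp
  ultimately show ?thesis
    using assms by (simp add: is_nahm_solution_def forall_2 UNIV_2 power_less_one_iff)
qed

section \<open>Convergence\<close>

lemma summable_gaussian:
  fixes a k :: real
  assumes "0 < a"
  shows "summable (\<lambda>n. exp (k * real n - a * (real n)\<^sup>2))"
proof (rule summable_comparison_test')
  \<comment> \<open>The exponent plus \<open>n\<close> is a concave quadratic in \<open>n\<close>, and \<open>C\<close> is \<open>exp\<close> of its maximum.\<close>
  define C where "C = exp ((k + 1)\<^sup>2 / (4 * a))"
  show "summable (\<lambda>n. C * exp (-1) ^ n)"
    by (intro summable_mult summable_geometric) simp
  show "norm (exp (k * real n - a * (real n)\<^sup>2)) \<le> C * exp (-1) ^ n" for n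
  proof -
    have "(k + 1)\<^sup>2 / (4 * a) - (k + 1) * real n + a * (real n)\<^sup>2
        = (2 * a * real n - (k + 1))\<^sup>2 / (4 * a)"
      using assms by (simp add: field_simps power2_eq_square)
    also have "\<dots> \<ge> 0" using assms by simp
    finally have "k * real n - a * (real n)\<^sup>2 \<le> (k + 1)\<^sup>2 / (4 * a) - real n"
      by (simp add: algebra_simps)
    then show ?thesis
      by (simp add: C_def flip: exp_of_nat_mult exp_add)
  qed
qed

lemma summable_on_gaussian_product:
  fixes a b k l :: real
  assumes "0 < a" "0 < b"
  shows "(\<lambda>(r, s). exp (k * real r - a * (real r)\<^sup>2) * exp (l * real s - b * (real s)\<^sup>2))
           summable_on (UNIV :: (nat \<times> nat) set)"
proof -
  have one: "(\<lambda>n. exp (k * real n - a * (real n)\<^sup>2)) summable_on UNIV"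
    if "0 < a" for a k :: real
    using summable_gaussian[OF that] by (subst summable_on_UNIV_nonneg_real_iff) auto
  have "(\<lambda>(r, s). exp (k * real r - a * (real r)\<^sup>2) * exp (l * real s - b * (real s)\<^sup>2))
           summable_on (UNIV \<times> (UNIV :: nat set))"
  proof (rule summable_on_SigmaI)
    fix r :: nat
    show "((\<lambda>s. case (r, s) of (r, s) \<Rightarrow>
         exp (k * real r - a * (real r)\<^sup>2) * exp (l * real s - b * (real s)\<^sup>2))
       has_sum exp (k * real r - a * (real r)\<^sup>2)
         * (\<Sum>\<^sub>\<infinity>s. exp (l * real s - b * (real s)\<^sup>2))) UNIV"
      using has_sum_cmult_right[OF has_sum_infsum[OF one[OF assms(2)]]] by simp
  qed (auto intro!: summable_on_cmult_left one assms)
  then show ?thesis by simp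
qed

lemma norm_qpow: "norm (qpow \<tau> t) = exp (- (2 * pi * Im \<tau> * t))"
  by (simp add: qpow_def norm_exp_eq_Re mult_ac)

text \<open>
  An exponentially small lower bound suffices against Gaussian numerators, so each factor
  may be bounded crudely by the same constant \<open>1 - p\<close>.
\<close>
lemma norm_qpoch_ge:
  assumes "norm x \<le> p" "norm q \<le> 1" "p \<le> 1"
  shows "(1 - p) ^ n \<le> norm (qpoch x q n)"
proof -
  have "1 - p \<le> norm (1 - x * q ^ j)" for j
  proof -
    have "norm (x * q ^ j) \<le> norm x * 1"
      using assms by (simp add: norm_mult norm_power mult_left_le power_le_one)
    then show ?thesis
      using norm_triangle_ineq2[of 1 "x * q ^ j"] assms by simp
  qed
  then have "(\<Prod>j<n. 1 - p) \<le> (\<Prod>j<n. norm (1 - x * q ^ j))"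
    using assms by (intro prod_mono) auto
  then show ?thesis by (simp add: qpoch_def prod_norm)
qed

lemma nahm_double_sum_summable:
  fixes l1 l2 :: real
  assumes "0 < Im \<tau>"
  shows "(\<lambda>(r, s). norm (qpow \<tau> (2 * real r ^ 2 + real r * real s + real s ^ 2
                                 + l1 * real r + l2 * real s) /
             (qpoch (qpow \<tau> 1) (qpow \<tau> 1) r * qpoch ((qpow \<tau> 1)\<^sup>2) ((qpow \<tau> 1)\<^sup>2) s)))
         summable_on UNIV"
proof -
  \<comment> \<open>\<open>exp (- h t)\<close> is the modulus of \<open>q^t\<close>, and \<open>exp K\<close> bounds that of the reciprocal of
      any single factor of the Pochhammer symbols.\<close>
  define h where "h = 2 * pi * Im \<tau>"
  define p where "p = norm (qpow \<tau> 1)"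
  define K where "K = - ln (1 - p)"
  have h: "0 < h" using assms by (simp add: h_def)
  have p: "0 < p" "p < 1" using h by (simp_all add: p_def norm_qpow h_def)
  have expK: "exp (- K * real n) = (1 - p) ^ n" for n
    using p by (simp add: K_def exp_of_nat2_mult[symmetric] exp_of_nat_mult mult.commute)
  have bound: "norm (qpow \<tau> (2 * real r ^ 2 + real r * real s + real s ^ 2
                                 + l1 * real r + l2 * real s) /
             (qpoch (qpow \<tau> 1) (qpow \<tau> 1) r * qpoch ((qpow \<tau> 1)\<^sup>2) ((qpow \<tau> 1)\<^sup>2) s))
      \<le> exp ((K - h * l1) * real r - 2 * h * (real r)\<^sup>2)
         * exp ((K - h * l2) * real s - h * (real s)\<^sup>2)" (is "norm (?a / (?b * ?c)) \<le> ?R")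
    for r s
  proof -
    have b: "(1 - p) ^ r \<le> norm ?b"
      by (rule norm_qpoch_ge) (use p in \<open>auto simp: p_def\<close>)
    have c: "(1 - p) ^ s \<le> norm ?c"
    proof (rule norm_qpoch_ge)
      show "norm ((qpow \<tau> 1)\<^sup>2) \<le> p" "norm ((qpow \<tau> 1)\<^sup>2) \<le> 1"
        using p power_le_one[of p 2] power_decreasing[of 1 2 p]
        by (simp_all add: norm_power flip: p_def)
    qed (use p in simp)
    have pos: "0 < (1 - p) ^ r * (1 - p) ^ s" using p by simp
    have "norm (?a / (?b * ?c)) = norm ?a / (norm ?b * norm ?c)"
      by (simp add: norm_divide norm_mult)
    also have "\<dots> \<le> norm ?a / ((1 - p) ^ r * (1 - p) ^ s)"
    proof (rule divide_left_mono)
      show le: "(1 - p) ^ r * (1 - p) ^ s \<le> norm ?b * norm ?c"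
        using b c p by (intro mult_mono) auto
      show "0 < norm ?b * norm ?c * ((1 - p) ^ r * (1 - p) ^ s)"
        using pos less_le_trans[OF pos le] by (rule mult_pos_pos[rotated])
    qed simp
    also have "\<dots> = exp (- h * (2 * real r ^ 2 + real r * real s + real s ^ 2
                                 + l1 * real r + l2 * real s) + K * real r + K * real s)"
      by (simp add: norm_qpow h_def exp_add exp_diff exp_minus divide_inverse flip: expK)
    \<comment> \<open>Dropping the cross term \<open>- h r s\<close> separates the variables.\<close>
    also have "\<dots> \<le> exp (((K - h * l1) * real r - 2 * h * (real r)\<^sup>2)
         + ((K - h * l2) * real s - h * (real s)\<^sup>2))"
      using h by (simp add: algebra_simps)
    finally show ?thesis by (simp only: exp_add)
  qed
  show ?thesis
    by (rule summable_on_comparison_test[OF summable_on_gaussian_product[of "2 * h" h "K - h * l1" "K - h * l2"]])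
       (use h bound in auto)
qed

lemma qpow_2: "qpow \<tau> 2 = (qpow \<tau> 1)\<^sup>2"
  by (simp add: qpow_def mult_ac flip: exp_double)

lemma nahm_term_half:
  "nahm_term (A_mat (1/2)) d_vec (vector [l1, l2]) \<tau> r s =
     qpow \<tau> (2 * real r ^ 2 + real r * real s + real s ^ 2 + l1 * real r + l2 * real s) /
       (qpoch (qpow \<tau> 1) (qpow \<tau> 1) r * qpoch ((qpow \<tau> 1)\<^sup>2) ((qpow \<tau> 1)\<^sup>2) s)"
proof -
  let ?v = "vector [real r, real s] :: real^2"
  have "?v \<bullet> ((A_mat (1/2) ** diag_matrix d_vec) *v ?v) / 2 + vector [l1, l2] \<bullet> ?v
      = 2 * real r ^ 2 + real r * real s + real s ^ 2 + l1 * real r + l2 * real s"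
    unfolding A_mat_quadratic_form by (simp add: inner_vec_def sum_2 field_simps)
  then show ?thesis by (simp add: nahm_term_def Let_def qpow_2)
qed

theorem proposition7p1:
  fixes \<eta> :: real
  assumes "0 < \<eta>" and "\<eta> < 1" and "\<eta> ^ 3 + \<eta> ^ 2 = 1"
  shows "(\<forall>b::real. b \<in> \<rat> \<and> 0 < b \<and> b < 15/16 \<longrightarrow>
            symmetric_positive_definite (A_mat b ** diag_matrix d_vec) \<and>
            0 < cross_term (A_mat b) d_vec \<and>
            (\<exists>!z. is_nahm_solution (A_mat b) z) \<and>
            positive_nahm_solution (A_mat b) = vector [\<eta>, \<eta> ^ 2] \<and>
            radial_action (A_mat b) d_vec = pi\<^sup>2 / 12) \<and>
         (\<forall>(l1::real) (l2::real) (\<tau>::complex).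
            l1 \<in> \<rat> \<and> l2 \<in> \<rat> \<and> 0 < Im \<tau> \<longrightarrow>
            (let q = qpow \<tau> 1;
                 f = (\<lambda>(r::nat) (s::nat).
                        qpow \<tau> (2 * real r ^ 2 + real r * real s + real s ^ 2
                                 + l1 * real r + l2 * real s) /
                        (qpoch q q r * qpoch (q ^ 2) (q ^ 2) s))
             in (\<forall>r s. nahm_term (A_mat (1/2)) d_vec (vector [l1, l2]) \<tau> r s = f r s) \<and>
                (\<lambda>(r, s). norm (f r s)) summable_on UNIV))"
proof (intro conjI allI impI)
  fix b :: real
  assume "b \<in> \<rat> \<and> 0 < b \<and> b < 15/16"
  then have b: "0 < b" "b < 15/16" by auto
  note spd = A_mat_spd[OF b(2)]
  have sol: "is_nahm_solution (A_mat b) (vector [\<eta>, \<eta> ^ 2])"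
    using A_mat_nahm_solution[OF assms] .
  have uniq: "z = vector [\<eta>, \<eta> ^ 2]" if "is_nahm_solution (A_mat b) z" for z
    using nahm_solution_unique[OF spd d_vec_pos that sol] .
  show "symmetric_positive_definite (A_mat b ** diag_matrix d_vec)" by (rule spd)
  show "0 < cross_term (A_mat b) d_vec"
    using b by (simp add: cross_term_def matrix_mul_diag_entry)
  show "\<exists>!z. is_nahm_solution (A_mat b) z"
    using sol uniq by blast
  show pos: "positive_nahm_solution (A_mat b) = vector [\<eta>, \<eta> ^ 2]"
    unfolding positive_nahm_solution_def using sol uniq by (rule the_equality)
  show "radial_action (A_mat b) d_vec = pi\<^sup>2 / 12"
    using rogers_L_plastic[OF assms]
    by (simp add: radial_action_def pos sum_2 rogers_L_1 field_simps)
next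
  fix l1 l2 :: real and \<tau> :: complex
  assume "l1 \<in> \<rat> \<and> l2 \<in> \<rat> \<and> 0 < Im \<tau>"
  then have "0 < Im \<tau>" by simp
  from nahm_double_sum_summable[OF this, of l1 l2]
  show "let q = qpow \<tau> 1;
                 f = (\<lambda>(r::nat) (s::nat).
                        qpow \<tau> (2 * real r ^ 2 + real r * real s + real s ^ 2
                                 + l1 * real r + l2 * real s) /
                        (qpoch q q r * qpoch (q ^ 2) (q ^ 2) s))
             in (\<forall>r s. nahm_term (A_mat (1/2)) d_vec (vector [l1, l2]) \<tau> r s = f r s) \<and>
                (\<lambda>(r, s). norm (f r s)) summable_on UNIV"
    by (simp add: Let_def nahm_term_half)
qed

end
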